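(* For every $n\geq 1$, the chromatic number $\gamma_n$ of the $n$-dimensional cyclohedron (with respect to proper colourings of its facets) satisfies $$\gamma_n\leq\sum_{i=2}^{\lceil n/2\rceil+1}(A_i+1),$$ where the integers $A_i,B_i$, $2\leq i\leq\lceil n/2\rceil+1$ (depending on $n$), are defined recursively by $$B_i=\begin{cases}0 & \text{if } i=2,\\ n+1+B_{i-1}-(i-1)A_{i-1} & \text{if } 2<i\leq\lceil n/2\rceil+1,\end{cases}$$ $$A_i=\begin{cases}\left\lceil\frac{n+1+B_i}{i}\right\rceil & \text{if } i\leq\lceil n/2\rceil,\\ 1 & \text{if } n \text{ is even and } i=\lceil n/2\rceil+1,\\ 0 & \text{if } n \text{ is odd and } i=\lceil n/2\rceil+1.\end{cases}$$
   Context: For $n\geq 1$ let $[n]=\{1,\ldots,n\}$ and $[n]_0=\{0,1,\ldots,n\}$. A building set is a collection $\mathcal{B}$ of nonempty subsets of $[n]_0$ containing all singletons $\{x\}$, $x\in[n]_0$, such that $S_1,S_2\in\mathcal{B}$ and $S_1\cap S_2\neq\emptyset$ imply $S_1\cup S_2\in\mathcal{B}$. For a family of sets $N$, an $N$-antichain is a subset $\{X_1,\ldots,X_m\}\subseteq N$ with $m\geq 2$ whose members are mutually incomparable with respect to $\subseteq$. Assuming $[n]_0\in\mathcal{B}$, a set $N\subseteq\mathcal{B}$ is nested when the union of every $N$-antichain is not an element of $\mathcal{B}$. The nested-set complex of $\mathcal{B}$ is the simplicial complex of all nested sets $N$ with $[n]_0\notin N$. It is realised by a simple $n$-dimensional polytope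 (the nestohedron of $\mathcal{B}$): its face lattice with the bottom (the empty face) removed is isomorphic to the complex ordered by $\supseteq$. Hence its facets are identified with the elements $X\in\mathcal{B}$, $X\neq[n]_0$, and two facets have a common vertex iff some nested set contains both. The $n$-dimensional cyclohedron is the nestohedron of the building set of all nonempty connected subsets of vertices of the cycle $0-1-\cdots-n-0$. Two facets of a polytope are separated when they have no vertex in common. For $\mathcal{F}$ the set of facets of a polytope, a function $f\colon\mathcal{F}\to[m]$ is a proper colouring when every two (distinct) facets of the same colour are separated. The chromatic number of the polytope is the minimal $m$ such that a proper colouring of its facets with $m$ colours exists. *)

theory Defs
  imports "HOL-Analysis.Analysis" "Graph_Theory.Digraph_Component"
begin

section \<open>Building sets and nested sets\<close>

definition building_set :: "nat \<Rightarrow> nat set set \<Rightarrow> bool" where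
  "building_set n \<B> \<longleftrightarrow>
     (\<forall>S\<in>\<B>. S \<noteq> {} \<and> S \<subseteq> {0..n}) \<and>
     (\<forall>x\<in>{0..n}. {x} \<in> \<B>) \<and>
     (\<forall>S\<^sub>1\<in>\<B>. \<forall>S\<^sub>2\<in>\<B>. S\<^sub>1 \<inter> S\<^sub>2 \<noteq> {} \<longrightarrow> S\<^sub>1 \<union> S\<^sub>2 \<in> \<B>)"

definition antichain_of :: "'a set set \<Rightarrow> 'a set set \<Rightarrow> bool" where
  "antichain_of N M \<longleftrightarrow>
     M \<subseteq> N \<and> finite M \<and> 2 \<le> card M \<and> (\<forall>X\<in>M. \<forall>Y\<in>M. X \<noteq> Y \<longrightarrow> \<not> X \<subseteq> Y)"

definition nested :: "nat set set \<Rightarrow> nat set set \<Rightarrow> bool" where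
  "nested \<B> N \<longleftrightarrow> N \<subseteq> \<B> \<and> (\<forall>M. antichain_of N M \<longrightarrow> \<Union>M \<notin> \<B>)"

definition nested_set_complex :: "nat \<Rightarrow> nat set set \<Rightarrow> nat set set set" where
  "nested_set_complex n \<B> = {N. nested \<B> N \<and> {0..n} \<notin> N}"


section \<open>Nestohedra and the cyclohedron\<close>

text \<open>
  A nestohedron is determined only up to combinatorial equivalence, so it is given as a predicate
  that holds for every polytope, in any Euclidean space, realising the nested-set complex.
  The condition on \<open>\<phi>\<close> says that it is an isomorphism from the poset of nonempty faces ordered by
  inclusion (\<open>P\<close> itself is a face) to the complex ordered by \<open>\<supseteq>\<close>. Simplicity of the polytope is a
  consequence of this condition and is not imposed separately.
\<close>

definition nestohedron :: "nat \<Rightarrow> nat set set \<Rightarrow> 'a::euclidean_space set \<Rightarrow> bool" where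
  "nestohedron n \<B> P \<longleftrightarrow>
     building_set n \<B> \<and> {0..n} \<in> \<B> \<and>
     polytope P \<and> aff_dim P = int n \<and>
     (\<exists>\<phi>. bij_betw \<phi> {F. F face_of P \<and> F \<noteq> {}} (nested_set_complex n \<B>) \<and>
          (\<forall>F G. F face_of P \<and> F \<noteq> {} \<and> G face_of P \<and> G \<noteq> {} \<longrightarrow>
                 (F \<subseteq> G \<longleftrightarrow> \<phi> F \<supseteq> \<phi> G)))"

definition cycle_digraph :: "nat \<Rightarrow> nat pair_pre_digraph" where
  "cycle_digraph n =
     \<lparr> pverts = {0..n}, parcs = {(x, y). x \<le> n \<and> y \<le> n \<and> y = (x + 1) mod (n + 1)} \<rparr>"

text \<open>
  The arcs above orient the cycle \<open>0 - 1 - \<dots> - n - 0\<close>; \<open>connected\<close> is connectedness of the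
  underlying undirected graph, and it requires a nonempty vertex set.
\<close>

definition cyclohedron_building_set :: "nat \<Rightarrow> nat set set" where
  "cyclohedron_building_set n =
     {S. S \<subseteq> {0..n} \<and> Digraph_Component.connected (with_proj (cycle_digraph n) \<restriction> S)}"

definition cyclohedron :: "nat \<Rightarrow> 'a::euclidean_space set \<Rightarrow> bool" where
  "cyclohedron n P \<longleftrightarrow> nestohedron n (cyclohedron_building_set n) P"


section \<open>Colourings of facets\<close>

definition facets :: "'a::euclidean_space set \<Rightarrow> 'a set set" where
  "facets P = {F. F facet_of P}"

definition separated :: "'a::euclidean_space set \<Rightarrow> 'a set \<Rightarrow> 'a set \<Rightarrow> bool" where
  "separated P F G \<longleftrightarrow> \<not> (\<exists>v. v extreme_point_of P \<and> v \<in> F \<and> v \<in> G)"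

definition proper_colouring :: "'a::euclidean_space set \<Rightarrow> nat \<Rightarrow> ('a set \<Rightarrow> nat) \<Rightarrow> bool" where
  "proper_colouring P m f \<longleftrightarrow>
     f ` facets P \<subseteq> {1..m} \<and>
     (\<forall>F\<in>facets P. \<forall>G\<in>facets P. F \<noteq> G \<and> f F = f G \<longrightarrow> separated P F G)"

definition chromatic_number :: "'a::euclidean_space set \<Rightarrow> nat" where
  "chromatic_number P = (LEAST m. \<exists>f. proper_colouring P m f)"


section \<open>The recursive bound\<close>

text \<open>Only the indices \<open>2 \<le> i \<le> \<lceil>n/2\<rceil> + 1\<close> are relevant; other values are junk.\<close>

function cyc_B :: "nat \<Rightarrow> nat \<Rightarrow> int" and cyc_A :: "nat \<Rightarrow> nat \<Rightarrow> int" where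
  "cyc_B n i =
     (if i \<le> 2 then 0
      else int n + 1 + cyc_B n (i - 1) - (int i - 1) * cyc_A n (i - 1))"
| "cyc_A n i =
     (if int i \<le> \<lceil>real n / 2\<rceil> then \<lceil>(real n + 1 + real_of_int (cyc_B n i)) / real i\<rceil>
      else if even n then 1 else 0)"
  by pat_completeness auto
termination
  by (relation "Wellfounded.measure (case_sum (\<lambda>(n, i). 2 * i) (\<lambda>(n, i). 2 * i + 1))") auto

declare cyc_B.simps [simp del] cyc_A.simps [simp del]


section \<open>The building set of the cyclohedron is a building set\<close>

lemma cyclohedron_building_set_iff:
  "S \<in> cyclohedron_building_set n \<longleftrightarrow>
     S \<subseteq> {0..n} \<and> S \<noteq> {} \<and>
     (\<forall>x\<in>S. \<forall>y\<in>S. (x, y) \<in> rtrancl_on S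
        {(u, v). u \<in> S \<and> v \<in> S \<and> (v = (u + 1) mod (n + 1) \<or> u = (v + 1) mod (n + 1))})"
proof -
  have "parcs (mk_symmetric (with_proj (cycle_digraph n) \<restriction> S)) =
      {(u, v). u \<in> S \<and> v \<in> S \<and> (v = (u + 1) mod (n + 1) \<or> u = (v + 1) mod (n + 1))}"
    if "S \<subseteq> {0..n}"
    using that
    by (fastforce simp: parcs_mk_symmetric arcs_ends_conv cycle_digraph_def image_iff)
  then show ?thesis
    by (auto simp: cyclohedron_building_set_def Digraph_Component.connected_def
        strongly_connected_def reachable_def)
qed

lemma building_set_cyclohedron: "building_set n (cyclohedron_building_set n)"
  unfolding building_set_def
proof (intro conjI ballI impI)
  fix S T
  assume S: "S \<in> cyclohedron_building_set n" and T: "T \<in> cyclohedron_building_set n"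
    and "S \<inter> T \<noteq> {}"
  then obtain z where z: "z \<in> S" "z \<in> T"
    by blast
  let ?r = "\<lambda>S. {(u, v). u \<in> S \<and> v \<in> S \<and> (v = (u + 1) mod (n + 1) \<or> u = (v + 1) mod (n + 1))}"
  have "rtrancl_on S (?r S) \<subseteq> rtrancl_on (S \<union> T) (?r (S \<union> T))"
    and "rtrancl_on T (?r T) \<subseteq> rtrancl_on (S \<union> T) (?r (S \<union> T))"
    by (auto intro: rtrancl_on_mono[rotated -1])
  then have *: "(x, z) \<in> rtrancl_on (S \<union> T) (?r (S \<union> T))"
    "(z, x) \<in> rtrancl_on (S \<union> T) (?r (S \<union> T))" if "x \<in> S \<union> T" for x
    using S T z that unfolding cyclohedron_building_set_iff by blast+
  then have "(x, y) \<in> rtrancl_on (S \<union> T) (?r (S \<union> T))"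
    if "x \<in> S \<union> T" "y \<in> S \<union> T" for x y
    using that by (blast intro: rtrancl_on_trans)
  then show "S \<union> T \<in> cyclohedron_building_set n"
    using S T unfolding cyclohedron_building_set_iff by blast
qed (auto simp: cyclohedron_building_set_iff)

lemma full_in_cyclohedron_building_set: "{0..n} \<in> cyclohedron_building_set n"
proof -
  let ?r = "{(u, v). u \<in> {0..n} \<and> v \<in> {0..n} \<and>
    (v = (u + 1) mod (n + 1) \<or> u = (v + 1) mod (n + 1))}"
  have *: "(0, x) \<in> rtrancl_on {0..n} ?r \<and> (x, 0) \<in> rtrancl_on {0..n} ?r" if "x \<le> n" for x
    using that
  proof (induction x)
    case (Suc x)
    then have "(x, Suc x) \<in> ?r" "(Suc x, x) \<in> ?r"
      by auto
    with Suc show ?case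
      by (meson Suc_leD atLeastAtMost_iff converse_rtrancl_on_into_rtrancl_on
          rtrancl_on_into_rtrancl_on zero_le)
  qed auto
  have "(x, y) \<in> rtrancl_on {0..n} ?r" if "x \<in> {0..n}" "y \<in> {0..n}" for x y
  proof (rule rtrancl_on_trans)
    show "(x, 0) \<in> rtrancl_on {0..n} ?r" using * [of x] that(1) by simp
    show "(0, y) \<in> rtrancl_on {0..n} ?r" using * [of y] that(2) by simp
  qed
  moreover have "{0..n} \<noteq> {}" by simp
  ultimately show ?thesis
    unfolding cyclohedron_building_set_iff by blast
qed

end

theory Submission
  imports Defs "HOL-Number_Theory.Cong"
begin

text \<open>
  A facet of the nestohedron of \<open>\<B>\<close> is labelled by an element of \<open>\<B>\<close>, and two facets are
  separated as soon as their labels \<^emph>\<open>cross\<close>: they are incomparable and their union lies in \<open>\<B>\<close>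
  (lemma \<open>nestohedron_facet_labels\<close>). For the cyclohedron the labels are the arcs of a cycle with
  \<open>N = n + 1\<close> vertices that have between \<open>1\<close> and \<open>n\<close> vertices, and two arcs have a union in the
  building set iff they overlap or are adjacent. It remains to partition the arcs into few classes
  of pairwise crossing arcs. Put \<open>h = \<lceil>n/2\<rceil>\<close>.

  Long arcs, of length \<open>l \<ge> h\<close>: two different arcs of length \<open>l\<close> cross, because one of them
  starts at most \<open>\<lfloor>N/2\<rfloor> \<le> l\<close> steps after the other. One colour for each length suffices, and the
  number \<open>n - h + 1\<close> of these lengths is what the summands \<open>1\<close> and the last term \<open>A\<^bsub>h+1\<^esub>\<close> add up to.

  Short arcs, of length less than \<open>h\<close>: list them by length, and arcs of equal length by their start,
  going round the cycle. Thus the arc number \<open>t\<close> has length \<open>t div N + 1\<close> and start \<open>t mod N\<close>, and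
  when the list passes to the next length the starts still advance by one step. If \<open>t < t'\<close> are
  at most \<open>t div N + 1\<close> apart then the arc \<open>t'\<close> starts inside or just behind the arc \<open>t\<close>, and it is
  too short to come back to the start of the arc \<open>t\<close>; hence the two arcs cross (lemma
  \<open>crossing_short_arcs\<close>). So the list may be cut into blocks: blocks of two from the beginning until
  all arcs of length \<open>1\<close> are exhausted, then blocks of three until all arcs of length \<open>2\<close> are
  exhausted, and so on. The last block of size \<open>i\<close> may contain some arcs of length \<open>i\<close>; their number
  is \<open>-B\<^bsub>i+1\<^esub>\<close>, and \<open>A\<^sub>i\<close> is the number of blocks of size \<open>i\<close> (lemma \<open>block_colouring\<close>).
\<close>

section \<open>Labels of the facets of a nestohedron\<close>

definition crossing :: "'a set set \<Rightarrow> 'a set \<Rightarrow> 'a set \<Rightarrow> bool" where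
  "crossing \<B> X Y \<longleftrightarrow> X \<union> Y \<in> \<B> \<and> \<not> X \<subseteq> Y \<and> \<not> Y \<subseteq> X"

lemma crossing_commute: "crossing \<B> X Y \<longleftrightarrow> crossing \<B> Y X"
  by (auto simp: crossing_def Un_commute)

lemma not_antichain_of_card_le_1:
  assumes "finite N" "card N \<le> 1"
  shows "\<not> antichain_of N M"
  using assms card_mono[of N M] by (auto simp: antichain_of_def)

lemma nested_not_crossing:
  assumes "nested \<B> N" "X \<in> N" "Y \<in> N"
  shows "\<not> crossing \<B> X Y"
proof
  assume cr: "crossing \<B> X Y"
  then have "X \<noteq> Y"
    by (auto simp: crossing_def)
  with cr assms(2,3) have "antichain_of N {X, Y}"
    by (auto simp: antichain_of_def crossing_def)
  with assms(1) have "\<Union>{X, Y} \<notin> \<B>"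
    unfolding nested_def by blast
  with cr show False
    by (simp add: crossing_def)
qed

lemma facet_of_maximal:
  assumes "convex P" "F facet_of P" "G face_of P" "F \<subseteq> G" "G \<noteq> P"
  shows "F = G"
proof (rule ccontr)
  assume "F \<noteq> G"
  have "F face_of P"
    using assms(2) by (simp add: facet_of_def)
  then have "F face_of G"
    using assms(3,4) by (meson face_of_imp_subset face_of_subset)
  moreover have "convex G"
    using assms(3) face_of_imp_convex by blast
  ultimately have "aff_dim F < aff_dim G"
    using \<open>F \<noteq> G\<close> face_of_aff_dim_lt by blast
  moreover have "aff_dim G < aff_dim P"
    using assms face_of_aff_dim_lt by blast
  ultimately show False
    using assms(2) by (auto simp: facet_of_def)
qed

text \<open>
  The isomorphism \<open>\<phi>\<close> reverses inclusion, so it sends the polytope to the empty nested set and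
  the facets, being the maximal proper faces, to the minimal nonempty nested sets, which are the
  singletons. A common vertex of two facets is sent to a nested set that contains both labels.
\<close>

lemma nestohedron_facet_labels:
  assumes "nestohedron n \<B> P"
  obtains X where "inj_on X (facets P)" "X ` facets P \<subseteq> \<B> - {{0..n}}"
    "\<And>F G. F \<in> facets P \<Longrightarrow> G \<in> facets P \<Longrightarrow> crossing \<B> (X F) (X G) \<Longrightarrow> separated P F G"
proof -
  let ?faces = "{F. F face_of P \<and> F \<noteq> {}}"
  let ?C = "nested_set_complex n \<B>"
  have P: "polytope P" "aff_dim P = int n"
    using assms by (simp_all add: nestohedron_def)
  obtain \<phi> where bij: "bij_betw \<phi> ?faces ?C"
    and reverse: "\<forall>F G. F face_of P \<and> F \<noteq> {} \<and> G face_of P \<and> G \<noteq> {} \<longrightarrow> (F \<subseteq> G \<longleftrightarrow> \<phi> F \<supseteq> \<phi> G)"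
    using assms unfolding nestohedron_def by (elim conjE exE) (rule that)
  have ord: "F \<subseteq> G \<longleftrightarrow> \<phi> G \<subseteq> \<phi> F"
    if "F face_of P" "F \<noteq> {}" "G face_of P" "G \<noteq> {}" for F G
    using reverse that by simp
  have "convex P"
    using P(1) by (simp add: polytope_imp_convex)
  have "P \<noteq> {}"
    using P(2) by auto
  have Pface: "P face_of P"
    using \<open>convex P\<close> by (simp add: face_of_refl)
  have image: "\<phi> ` ?faces = ?C"
    using bij by (rule bij_betw_imp_surj_on)
  have surj: "\<exists>F. F face_of P \<and> F \<noteq> {} \<and> \<phi> F = N" if "N \<in> ?C" for N
  proof -
    have "N \<in> \<phi> ` ?faces"
      using that image by simp
    then show ?thesis
      by auto
  qed
  have inC: "\<phi> F \<in> ?C" if "F face_of P" "F \<noteq> {}" for F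
    unfolding image[symmetric] using that by simp
  have inj: "F = G" if "\<phi> F = \<phi> G" "F face_of P" "F \<noteq> {}" "G face_of P" "G \<noteq> {}" for F G
    using ord that by (metis subset_antisym order_refl)
  have "{} \<in> ?C"
    using not_antichain_of_card_le_1[of "{}"] by (auto simp: nested_set_complex_def nested_def)
  then obtain E where "E face_of P" "E \<noteq> {}" "\<phi> E = {}"
    using surj by blast
  then have \<phi>P: "\<phi> P = {}"
    using ord[of E P] Pface \<open>P \<noteq> {}\<close> face_of_imp_subset by blast
  have label: "\<exists>x. \<phi> F = {x} \<and> x \<in> \<B> - {{0..n}}" if "F \<in> facets P" for F
  proof -
    have F: "F facet_of P" "F face_of P" "F \<noteq> {}"
      using that by (auto simp: facets_def facet_of_def)
    have "F \<noteq> P"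
      using F(1) by (auto simp: facet_of_def)
    then have "\<phi> F \<noteq> {}"
      using inj \<phi>P F Pface \<open>P \<noteq> {}\<close> by metis
    then obtain x where x: "x \<in> \<phi> F"
      by blast
    have xB: "x \<in> \<B> - {{0..n}}"
      using inC[of F] F x by (auto simp: nested_set_complex_def nested_def)
    then have "{x} \<in> ?C"
      using not_antichain_of_card_le_1[of "{x}"] by (auto simp: nested_set_complex_def nested_def)
    then obtain G where G: "G face_of P" "G \<noteq> {}" "\<phi> G = {x}"
      using surj by blast
    have "F \<subseteq> G"
      using ord[of F G] F G x by simp
    moreover have "G \<noteq> P"
      using G \<phi>P by auto
    ultimately have "F = G"
      using facet_of_maximal[OF \<open>convex P\<close>] F G by blast
    then show ?thesis
      using G xB by blast
  qed
  then obtain X where X: "\<And>F. F \<in> facets P \<Longrightarrow> \<phi> F = {X F} \<and> X F \<in> \<B> - {{0..n}}"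
    by metis
  have face: "F face_of P" "F \<noteq> {}" if "F \<in> facets P" for F
    using that by (auto simp: facets_def facet_of_def)
  show thesis
  proof
    show "inj_on X (facets P)"
      using X face inj by (intro inj_onI) metis
    show "X ` facets P \<subseteq> \<B> - {{0..n}}"
      using X by blast
    fix F G
    assume FG: "F \<in> facets P" "G \<in> facets P" and cr: "crossing \<B> (X F) (X G)"
    show "separated P F G"
      unfolding separated_def
    proof
      assume "\<exists>v. v extreme_point_of P \<and> v \<in> F \<and> v \<in> G"
      then obtain v where v: "{v} face_of P" "v \<in> F" "v \<in> G"
        by (auto simp: face_of_singleton)
      then have "X F \<in> \<phi> {v}" "X G \<in> \<phi> {v}"
        using ord[of "{v}" F] ord[of "{v}" G] X[of F] X[of G] face FG by auto
      moreover have "nested \<B> (\<phi> {v})"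
        using inC[of "{v}"] v by (simp add: nested_set_complex_def)
      ultimately show False
        using nested_not_crossing cr by blast
    qed
  qed
qed

section \<open>Arcs of a cycle\<close>

definition cyc_arc :: "nat \<Rightarrow> nat \<Rightarrow> nat \<Rightarrow> nat set" where
  "cyc_arc N a l = (\<lambda>j. (a + j) mod N) ` {..<l}"

lemma cyc_arc_mod: "cyc_arc N (a mod N) l = cyc_arc N a l"
  by (simp add: cyc_arc_def mod_add_left_eq)

lemma cyc_arc_cong: "a mod N = b mod N \<Longrightarrow> cyc_arc N a l = cyc_arc N b l"
  using cyc_arc_mod[of N a l] cyc_arc_mod[of N b l] by simp

lemma card_cyc_arc:
  assumes "l \<le> N"
  shows "card (cyc_arc N a l) = l"
proof -
  have "inj_on (\<lambda>j. (a + j) mod N) {..<l}"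
  proof (rule inj_onI)
    fix x y assume "x \<in> {..<l}" "y \<in> {..<l}" "(a + x) mod N = (a + y) mod N"
    then have "[x = y] (mod N)" "x < N" "y < N"
      using assms by (auto simp: cong_def[symmetric] cong_add_lcancel_nat)
    then show "x = y"
      by (simp add: cong_def)
  qed
  then show ?thesis
    by (simp add: cyc_arc_def card_image)
qed

lemma cyc_arc_Un:
  assumes "d \<le> l"
  shows "cyc_arc N a l \<union> cyc_arc N (a + d) l' = cyc_arc N a (max l (d + l'))"
proof -
  have "(\<lambda>j. d + j) ` {..<l'} = {d..<d + l'}"
    unfolding lessThan_atLeast0 by (simp add: add.commute)
  then have "cyc_arc N (a + d) l' = (\<lambda>j. (a + j) mod N) ` {d..<d + l'}"
    by (metis (no_types, lifting) add.assoc cyc_arc_def image_cong image_image)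
  then show ?thesis
    using assms by (simp add: cyc_arc_def flip: image_Un) (rule arg_cong[of _ _ "image _"], auto)
qed

lemma start_notin_cyc_arc:
  assumes "0 < d" "d + l \<le> N"
  shows "a mod N \<notin> cyc_arc N (a + d) l"
proof
  assume "a mod N \<in> cyc_arc N (a + d) l"
  then obtain j where "j < l" "(a + (d + j)) mod N = (a + 0) mod N"
    by (auto simp: cyc_arc_def add.assoc)
  then have "[d + j = 0] (mod N)" "d + j < N"
    using assms by (auto simp only: cong_def[symmetric] cong_add_lcancel_nat)
  then show False
    using assms(1) by (simp add: cong_def)
qed

lemma cyclohedron_building_set_Un:
  assumes "S \<in> cyclohedron_building_set n" "T \<in> cyclohedron_building_set n" "S \<inter> T \<noteq> {}"
  shows "S \<union> T \<in> cyclohedron_building_set n"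
  using building_set_cyclohedron[of n] assms unfolding building_set_def by simp

lemma edge_in_cyclohedron_building_set:
  "{a mod Suc n, Suc a mod Suc n} \<in> cyclohedron_building_set n"
proof -
  let ?u = "a mod Suc n" and ?v = "Suc a mod Suc n"
  let ?r = "{(x, y). x \<in> {?u, ?v} \<and> y \<in> {?u, ?v} \<and>
    (y = (x + 1) mod (n + 1) \<or> x = (y + 1) mod (n + 1))}"
  have "?v = (?u + 1) mod (n + 1)"
    by (simp add: mod_Suc_eq)
  then have "(?u, ?v) \<in> ?r" "(?v, ?u) \<in> ?r"
    by auto
  then have "(x, y) \<in> rtrancl_on {?u, ?v} ?r" if "x \<in> {?u, ?v}" "y \<in> {?u, ?v}" for x y
    using that
    by (metis (no_types, lifting) insertE singletonD insertI1 insertI2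
        rtrancl_on.rtrancl_on_refl rtrancl_on_into_rtrancl_on)
  then show ?thesis
    unfolding cyclohedron_building_set_iff by (auto simp: less_Suc_eq_le[symmetric])
qed

lemma cyc_arc_in_cyclohedron_building_set:
  "cyc_arc (Suc n) a (Suc l) \<in> cyclohedron_building_set n"
proof (induction l)
  case 0
  have "{a mod Suc n} \<in> cyclohedron_building_set n"
    using building_set_cyclohedron[of n]
    by (auto simp: building_set_def less_Suc_eq_le[symmetric])
  then show ?case
    by (simp add: cyc_arc_def lessThan_Suc)
next
  case (Suc l)
  let ?e = "{(a + l) mod Suc n, Suc (a + l) mod Suc n}"
  have eq: "cyc_arc (Suc n) a (Suc (Suc l)) = cyc_arc (Suc n) a (Suc l) \<union> ?e"
    by (auto simp: cyc_arc_def lessThan_Suc)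
  have "cyc_arc (Suc n) a (Suc l) \<inter> ?e \<noteq> {}"
    by (auto simp: cyc_arc_def lessThan_Suc)
  then show ?case
    unfolding eq
    by (intro cyclohedron_building_set_Un Suc.IH edge_in_cyclohedron_building_set)
qed

lemma rtrancl_on_invariant:
  assumes "(x, y) \<in> rtrancl_on S r" "x \<in> I" "\<And>u v. u \<in> I \<Longrightarrow> (u, v) \<in> r \<Longrightarrow> v \<in> I"
  shows "y \<in> I"
  using assms(1,2) by (induction rule: rtrancl_on.induct) (use assms(3) in blast)+

text \<open>
  Walking round the cycle from a vertex outside \<open>S\<close>, let \<open>a\<close> be the first vertex met in \<open>S\<close> and
  \<open>a + l\<close> the first one after it outside \<open>S\<close>. The arc between them cannot be left within \<open>S\<close>.
\<close>

lemma cyclohedron_building_set_arc: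
  assumes "S \<in> cyclohedron_building_set n" "S \<noteq> {0..n}"
  obtains a l where "a \<le> n" "0 < l" "l \<le> n" "S = cyc_arc (Suc n) a l"
proof -
  let ?N = "Suc n"
  let ?r = "{(u, v). u \<in> S \<and> v \<in> S \<and> (v = (u + 1) mod (n + 1) \<or> u = (v + 1) mod (n + 1))}"
  have S: "S \<subseteq> {0..n}" "S \<noteq> {}" and conn: "\<And>x y. x \<in> S \<Longrightarrow> y \<in> S \<Longrightarrow> (x, y) \<in> rtrancl_on S ?r"
    using assms(1) unfolding cyclohedron_building_set_iff by blast+
  have "\<not> {0..n} \<subseteq> S"
    using S(1) assms(2) by (meson subset_antisym)
  then obtain x where x: "x \<le> n" "x \<notin> S"
    by (meson atLeastAtMost_iff subsetI)
  obtain z where z: "z \<in> S" "z \<le> n"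
    using S by (auto simp: subset_iff)
  have "x + (z + ?N - x) = z + ?N"
    using x by simp
  then have "(x + (z + ?N - x)) mod ?N = z mod ?N"
    by (simp only: mod_add_self2)
  then have "(x + (z + ?N - x)) mod ?N \<in> S"
    using z by simp
  then have "\<exists>k. (x + k) mod ?N \<in> S"
    by (rule exI)
  then obtain k where k: "(x + k) mod ?N \<in> S" and k_least: "\<forall>j<k. (x + j) mod ?N \<notin> S"
    unfolding exists_least_iff[of "\<lambda>k. (x + k) mod ?N \<in> S"] by (elim exE conjE) (rule that)
  have "k \<noteq> 0"
    using k x by (intro notI) simp
  then obtain k' where k': "k = Suc k'"
    using not0_implies_Suc by blast
  define p where "p = x + k'"
  have p: "p mod ?N \<notin> S" "Suc p mod ?N \<in> S"
    using k k_least by (simp_all add: p_def k')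
  define a where "a = Suc p mod ?N"
  have a_eq: "(a + j) mod ?N = (Suc p + j) mod ?N" for j
    unfolding a_def by (simp only: mod_add_left_eq)
  have a_n: "(a + n) mod ?N \<notin> S"
    using p(1) unfolding a_eq by (metis add_Suc_shift mod_add_self2)
  then have "\<exists>l. (a + l) mod ?N \<notin> S"
    by (rule exI)
  then obtain l where l: "(a + l) mod ?N \<notin> S" and l_least: "\<forall>j<l. (a + j) mod ?N \<in> S"
    unfolding exists_least_iff[of "\<lambda>l. (a + l) mod ?N \<notin> S"] not_not
    by (elim exE conjE) (rule that)
  have "l \<le> n"
    using a_n l_least by (meson not_le)
  have "a \<in> S" "a \<le> n"
    using p(2) by (auto simp: a_def less_Suc_eq_le[symmetric])
  then have "l > 0"
    using l by (cases l) auto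
  have "y \<in> cyc_arc ?N a l" if "y \<in> S" for y
  proof (rule rtrancl_on_invariant[OF conn[OF \<open>a \<in> S\<close> that]])
    show "a \<in> cyc_arc ?N a l"
      using \<open>l > 0\<close> \<open>a \<le> n\<close> by (auto simp: cyc_arc_def image_iff intro!: bexI[of _ 0])
  next
    fix u v assume u: "u \<in> cyc_arc ?N a l" and uv: "(u, v) \<in> ?r"
    then obtain j where j: "j < l" "u = (a + j) mod ?N"
      by (auto simp: cyc_arc_def)
    have v: "v \<in> S" "v \<le> n"
      using uv S by auto
    from uv consider "v = (u + 1) mod ?N" | "u = (v + 1) mod ?N"
      by auto
    then show "v \<in> cyc_arc ?N a l"
    proof cases
      case 1
      then have v_eq: "v = (a + Suc j) mod ?N"
        using j by (simp add: mod_Suc_eq)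
      then have "Suc j \<noteq> l"
        using v l by auto
      then show ?thesis
        using j v_eq unfolding cyc_arc_def by (intro image_eqI[of _ _ "Suc j"]) auto
    next
      case 2
      then have "[v + 1 = p + j + 1] (mod ?N)"
        using j unfolding a_eq by (simp add: cong_def)
      then have "v mod ?N = (p + j) mod ?N"
        by (simp only: cong_add_rcancel_nat) (simp add: cong_def)
      then have v_eq: "v = (p + j) mod ?N"
        using v by simp
      then obtain i where "j = Suc i"
        using p(1) v by (cases j) auto
      then show ?thesis
        using j v_eq a_eq[of i] unfolding cyc_arc_def by (intro image_eqI[of _ _ i]) auto
    qed
  qed
  then have "S = cyc_arc ?N a l"
    using l_least by (auto simp: cyc_arc_def)
  then show thesis
    using that \<open>a \<le> n\<close> \<open>l > 0\<close> \<open>l \<le> n\<close> by blast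
qed

section \<open>Crossing arcs\<close>

lemma crossing_cyc_arcI:
  assumes "d \<le> l" "0 < l" "l \<le> l'" "l' \<le> Suc n" "\<not> cyc_arc (Suc n) a l \<subseteq> cyc_arc (Suc n) (a + d) l'"
  shows "crossing (cyclohedron_building_set n) (cyc_arc (Suc n) a l) (cyc_arc (Suc n) (a + d) l')"
proof -
  let ?X = "cyc_arc (Suc n) a l" and ?Y = "cyc_arc (Suc n) (a + d) l'"
  have "Suc (max l (d + l') - 1) = max l (d + l')"
    using assms(2) by simp
  then have "?X \<union> ?Y \<in> cyclohedron_building_set n"
    using cyc_arc_in_cyclohedron_building_set cyc_arc_Un[OF assms(1)] by metis
  moreover have "\<not> ?Y \<subseteq> ?X"
  proof
    assume "?Y \<subseteq> ?X"
    moreover have "finite ?X"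
      by (simp add: cyc_arc_def)
    moreover have "card ?X \<le> card ?Y"
      using assms by (simp add: card_cyc_arc)
    ultimately have "?Y = ?X"
      by (simp add: card_seteq)
    with assms(5) show False
      by simp
  qed
  ultimately show ?thesis
    using assms(5) by (simp add: crossing_def)
qed

lemma crossing_long_arcs:
  assumes "a \<le> n" "b \<le> n" "n \<le> 2 * l" "0 < l" "l \<le> n"
    and neq: "cyc_arc (Suc n) a l \<noteq> cyc_arc (Suc n) b l"
  shows "crossing (cyclohedron_building_set n) (cyc_arc (Suc n) a l) (cyc_arc (Suc n) b l)"
  using assms(1,2) neq
proof (induction a b rule: linorder_wlog)
  case (le a b)
  have incomp: "\<not> cyc_arc (Suc n) x l \<subseteq> cyc_arc (Suc n) y l"
    if "cyc_arc (Suc n) x l \<noteq> cyc_arc (Suc n) y l" for x y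
    using that card_seteq[of "cyc_arc (Suc n) y l" "cyc_arc (Suc n) x l"] assms(5)
    by (auto simp: card_cyc_arc) (simp add: cyc_arc_def)
  \<comment> \<open>The distances from \<open>a\<close> to \<open>b\<close> and from \<open>b\<close> to \<open>a\<close> add up to \<open>n + 1\<close>, so one of them is at
    most \<open>l\<close>.\<close>
  show ?case
  proof (cases "b - a \<le> l")
    case True
    then show ?thesis
      using crossing_cyc_arcI[of "b - a" l l n a] incomp[of a b] le assms by simp
  next
    case False
    have "b + (a + Suc n - b) = a + Suc n"
      using le by simp
    then have "cyc_arc (Suc n) (b + (a + Suc n - b)) l = cyc_arc (Suc n) a l"
      by (simp only: cyc_arc_cong[OF mod_add_self2])
    then show ?thesis
      using crossing_cyc_arcI[of "a + Suc n - b" l l n b] incomp[of b a] le assms False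
        crossing_commute
      by fastforce
  qed
next
  case (sym a b)
  then show ?case
    using crossing_commute by metis
qed

text \<open>
  The length bound \<open>2 * (t' div (n + 1) + 1) \<le> n + 1\<close> is what keeps the later arc from reaching
  the start of the earlier one.
\<close>

lemma crossing_short_arcs:
  fixes n t t' :: nat
  defines "len \<equiv> \<lambda>t. t div Suc n + 1"
  assumes "t < t'" "t' - t \<le> len t" "2 * len t' \<le> Suc n"
  shows "crossing (cyclohedron_building_set n)
    (cyc_arc (Suc n) t (len t)) (cyc_arc (Suc n) t' (len t'))"
proof -
  have "len t \<le> len t'"
    using assms(2) by (simp add: len_def div_le_mono)
  have "t mod Suc n \<notin> cyc_arc (Suc n) (t + (t' - t)) (len t')"
    using assms \<open>len t \<le> len t'\<close> by (intro start_notin_cyc_arc) linarith+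
  moreover have "t mod Suc n \<in> cyc_arc (Suc n) t (len t)"
    by (auto simp: cyc_arc_def len_def intro!: image_eqI[of _ _ 0])
  ultimately have "\<not> cyc_arc (Suc n) t (len t) \<subseteq> cyc_arc (Suc n) (t + (t' - t)) (len t')"
    by blast
  then show ?thesis
    using crossing_cyc_arcI[of "t' - t" "len t" "len t'" n t] assms \<open>len t \<le> len t'\<close>
    by (simp add: len_def)
qed

section \<open>Cutting the list of short arcs into blocks\<close>

lemma cyc_A_bounds:
  assumes "0 < i" "int i \<le> \<lceil>real n / 2\<rceil>"
  shows "int n + 1 + cyc_B n i \<le> int i * cyc_A n i"
    and "int i * cyc_A n i < int n + 1 + cyc_B n i + int i"
proof -
  define x where "x = int n + 1 + cyc_B n i"
  have A: "cyc_A n i = \<lceil>real_of_int x / real i\<rceil>"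
    using assms(2) by (subst cyc_A.simps) (simp add: x_def)
  have "real_of_int x / real i \<le> real_of_int (cyc_A n i)"
    "real_of_int (cyc_A n i) < real_of_int x / real i + 1"
    unfolding A by linarith+
  then have "real_of_int x \<le> real_of_int (int i * cyc_A n i)"
    "real_of_int (int i * cyc_A n i) < real_of_int (x + int i)"
    using assms(1) by (simp_all add: field_simps)
  then show "int n + 1 + cyc_B n i \<le> int i * cyc_A n i"
    "int i * cyc_A n i < int n + 1 + cyc_B n i + int i"
    unfolding x_def by linarith+
qed

lemma cyc_B_Suc:
  assumes "2 \<le> i"
  shows "cyc_B n (Suc i) = int n + 1 + cyc_B n i - int i * cyc_A n i"
  using assms by (subst cyc_B.simps) simp

lemma cyc_B_bounds:
  assumes "2 \<le> i" "int i \<le> \<lceil>real n / 2\<rceil> + 1"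
  shows "cyc_B n i \<le> 0 \<and> - int i < cyc_B n i"
  using assms
proof (induction i rule: dec_induct)
  case base
  show ?case
    by (simp add: cyc_B.simps)
next
  case (step i)
  then show ?case
    using cyc_A_bounds[of i n] cyc_B_Suc[of i n] by simp
qed

lemma cyc_A_nonneg:
  assumes "2 \<le> i" "int i \<le> \<lceil>real n / 2\<rceil>"
  shows "0 \<le> cyc_A n i"
proof -
  have "int i \<le> int n + 1"
    using assms(2) by linarith
  then have "0 < int n + 1 + cyc_B n i"
    using cyc_B_bounds[of i n] assms by linarith
  then have "0 < int i * cyc_A n i"
    using cyc_A_bounds(1)[of i n] assms by linarith
  then show ?thesis
    by (simp add: zero_less_mult_iff)
qed

text \<open>
  The blocks of size \<open>2, \<dots>, k\<close> together cover the first \<open>(n + 1) * (k - 1) - B\<^bsub>k+1\<^esub>\<close> numbers. Since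
  \<open>B\<^bsub>k+1\<^esub> \<le> 0\<close>, every number in a block of size \<open>k + 1\<close> is at least \<open>(n + 1) * (k - 1)\<close>, so that the
  diameter \<open>k\<close> of the block is at most the length of the arcs in it.
\<close>

lemma block_colouring:
  assumes "1 \<le> k" "int k \<le> \<lceil>real n / 2\<rceil>"
  shows "\<exists>g :: nat \<Rightarrow> int.
    (\<forall>t. int t < (int n + 1) * (int k - 1) - cyc_B n (Suc k) \<longrightarrow>
         0 \<le> g t \<and> g t < (\<Sum>i = 2..k. cyc_A n i)) \<and>
    (\<forall>t t'. t < t' \<longrightarrow> int t' < (int n + 1) * (int k - 1) - cyc_B n (Suc k) \<longrightarrow>
         g t = g t' \<longrightarrow> t' - t \<le> t div Suc n + 1)"
  using assms
proof (induction k rule: dec_induct)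
  case base
  show ?case
    by (simp add: cyc_B.simps)
next
  case (step k)
  define C where "C = (\<Sum>i = 2..k. cyc_A n i)"
  define A where "A = cyc_A n (Suc k)"
  define s where "s = (int n + 1) * (int k - 1) - cyc_B n (Suc k)"
  define s' where "s' = (int n + 1) * (int (Suc k) - 1) - cyc_B n (Suc (Suc k))"
  have s': "s' = s + int (Suc k) * A"
    using cyc_B_Suc[of "Suc k" n] step.hyps by (simp add: s_def s'_def A_def algebra_simps)
  have s_ge: "int (Suc n * (k - 1)) \<le> s"
  proof -
    have "int (Suc n * (k - 1)) = (int n + 1) * (int k - 1)"
      unfolding of_nat_mult using step.hyps by (simp add: of_nat_diff)
    then show ?thesis
      using cyc_B_bounds[of "Suc k" n] step by (simp add: s_def)
  qed
  have sum: "(\<Sum>i = 2..Suc k. cyc_A n i) = C + A"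
    using step.hyps by (simp add: C_def A_def)
  obtain g :: "nat \<Rightarrow> int" where g: "\<And>t. int t < s \<Longrightarrow> 0 \<le> g t \<and> g t < C"
    and g_eq: "\<And>t t'. t < t' \<Longrightarrow> int t' < s \<Longrightarrow> g t = g t' \<Longrightarrow> t' - t \<le> t div Suc n + 1"
    using step unfolding C_def s_def by auto
  have "C \<ge> 0"
    unfolding C_def using step.prems by (intro sum_nonneg cyc_A_nonneg) auto
  have "A \<ge> 0"
    unfolding A_def using step by (intro cyc_A_nonneg) auto
  define g' where "g' t = (if int t < s then g t else C + (int t - s) div int (Suc k))" for t
  have "0 \<le> g' t \<and> g' t < C + A" if t: "int t < s'" for t
  proof (cases "int t < s")
    case True
    then show ?thesis
      using g[of t] \<open>A \<ge> 0\<close> by (simp add: g'_def)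
  next
    case False
    have "int (Suc k) * ((int t - s) div int (Suc k)) \<le> int t - s"
      using pos_mod_sign[of "int (Suc k)" "int t - s"] mult_div_mod_eq[of "int (Suc k)" "int t - s"]
      by linarith
    also have "\<dots> < int (Suc k) * A"
      using t s' by linarith
    finally have "(int t - s) div int (Suc k) < A"
      by (rule mult_left_less_imp_less) simp
    moreover have "0 \<le> (int t - s) div int (Suc k)"
      using False by (simp add: pos_imp_zdiv_nonneg_iff)
    ultimately show ?thesis
      using False \<open>C \<ge> 0\<close> by (simp add: g'_def)
  qed
  moreover have "t' - t \<le> t div Suc n + 1" if "t < t'" "int t' < s'" and eq: "g' t = g' t'" for t t'
  proof (cases "int t' < s")
    case True
    then show ?thesis
      using g_eq[of t t'] that by (simp add: g'_def)
  next
    case t': False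
    then have "C \<le> g' t'"
      by (simp add: g'_def pos_imp_zdiv_nonneg_iff)
    then have t: "\<not> int t < s"
      using g[of t] eq by (auto simp: g'_def)
    define q where "q = (int t - s) div int (Suc k)"
    have q: "q = (int t' - s) div int (Suc k)"
      using eq t t' by (simp add: g'_def q_def)
    have "int t' - s < int (Suc k) * q + int (Suc k)"
      using mult_div_mod_eq[of "int (Suc k)" "int t' - s"]
        pos_mod_bound[of "int (Suc k)" "int t' - s"] unfolding q by linarith
    moreover have "int (Suc k) * q \<le> int t - s"
      using mult_div_mod_eq[of "int (Suc k)" "int t - s"]
        pos_mod_sign[of "int (Suc k)" "int t - s"] unfolding q_def by linarith
    ultimately have "t' - t \<le> k"
      by linarith
    moreover have "Suc n * (k - 1) \<le> t"
      using t s_ge by linarith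
    then have "k - 1 \<le> t div Suc n"
      by (simp add: less_eq_div_iff_mult_less_eq mult.commute)
    ultimately show ?thesis
      by linarith
  qed
  ultimately show ?case
    unfolding sum s'_def[symmetric] by blast
qed

lemma short_arc_colouring:
  assumes "1 \<le> h" "int h = \<lceil>real n / 2\<rceil>"
  obtains g :: "nat \<Rightarrow> int" where
    "\<And>t. t < Suc n * (h - 1) \<Longrightarrow> 0 \<le> g t \<and> g t < (\<Sum>i = 2..h. cyc_A n i)"
    "\<And>t t'. t < t' \<Longrightarrow> t' < Suc n * (h - 1) \<Longrightarrow> g t = g t' \<Longrightarrow> t' - t \<le> t div Suc n + 1"
proof -
  have "int (Suc n * (h - 1)) \<le> (int n + 1) * (int h - 1) - cyc_B n (Suc h)"
  proof -
    have "int (Suc n * (h - 1)) = (int n + 1) * (int h - 1)"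
      unfolding of_nat_mult using assms(1) by (simp add: of_nat_diff)
    moreover have "cyc_B n (Suc h) \<le> 0"
      using cyc_B_bounds[of "Suc h" n] assms by simp
    ultimately show ?thesis
      by linarith
  qed
  then have "int t < (int n + 1) * (int h - 1) - cyc_B n (Suc h)" if "t < Suc n * (h - 1)" for t
    using that by linarith
  with block_colouring[of h n] assms that show thesis
    by (metis order_refl)
qed

section \<open>The colouring of the facets\<close>

lemma chromatic_number_le:
  assumes "proper_colouring P m f"
  shows "chromatic_number P \<le> m"
  unfolding chromatic_number_def using assms by (intro Least_le) blast

text \<open>
  The two summands count the blocks of short arcs and the \<open>n - h + 1\<close> lengths of long arcs, where
  \<open>n - h + 1\<close> is \<open>h\<close> for odd \<open>n\<close> and \<open>h + 1\<close> for even \<open>n\<close>.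
\<close>

lemma bound_eq:
  assumes "1 \<le> h" "int h = \<lceil>real n / 2\<rceil>"
  shows "(\<Sum>i = 2..h + 1. (cyc_A n i + 1)) = (\<Sum>i = 2..h. cyc_A n i) + (int n - int h + 1)"
proof -
  have "n \<le> 2 * h" "2 * h \<le> Suc n"
    using assms(2) by linarith+
  then have parity: "n = 2 * h \<or> Suc n = 2 * h"
    by linarith
  then have "even n \<longleftrightarrow> n = 2 * h"
    by presburger
  then have "cyc_A n (Suc h) = (if n = 2 * h then 1 else 0)"
    using assms by (subst cyc_A.simps) simp
  then have "cyc_A n (Suc h) + int h = int n - int h + 1"
    using parity by (auto split: if_splits)
  then show ?thesis
    using assms(1) by (simp add: sum.distrib)
qed

theorem theorem5p4:
  fixes n :: nat and P :: "'a::euclidean_space set"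
  assumes "n \<ge> 1" and "cyclohedron n P"
  shows "int (chromatic_number P) \<le> (\<Sum>i = 2..nat \<lceil>real n / 2\<rceil> + 1. (cyc_A n i + 1))"
proof -
  let ?B = "cyclohedron_building_set n"
  define h where "h = nat \<lceil>real n / 2\<rceil>"
  have h: "1 \<le> h" "int h = \<lceil>real n / 2\<rceil>"
    using assms(1) unfolding h_def by linarith+
  have h2: "n \<le> 2 * h" "2 * h \<le> Suc n"
    using h(2) by linarith+
  define C where "C = (\<Sum>i = 2..h. cyc_A n i)"
  have "C \<ge> 0"
    unfolding C_def using h by (intro sum_nonneg cyc_A_nonneg) auto
  obtain X where inj: "inj_on X (facets P)" and X: "X ` facets P \<subseteq> ?B - {{0..n}}"
    and sep: "\<And>F G. F \<in> facets P \<Longrightarrow> G \<in> facets P \<Longrightarrow> crossing ?B (X F) (X G) \<Longrightarrow> separated P F G"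
    using nestohedron_facet_labels assms(2) unfolding cyclohedron_def by blast
  have "\<exists>a l. a \<le> n \<and> 0 < l \<and> l \<le> n \<and> X F = cyc_arc (Suc n) a l" if "F \<in> facets P" for F
    using X that cyclohedron_building_set_arc by (metis DiffE image_subset_iff singletonI)
  then obtain a l where arc: "\<And>F. F \<in> facets P \<Longrightarrow>
      a F \<le> n \<and> 0 < l F \<and> l F \<le> n \<and> X F = cyc_arc (Suc n) (a F) (l F)"
    by metis
  define t where "t F = Suc n * (l F - 1) + a F" for F
  have t: "t F div Suc n + 1 = l F" "cyc_arc (Suc n) (t F) (l F) = X F" if "F \<in> facets P" for F
  proof -
    show "t F div Suc n + 1 = l F"
      using arc[OF that] by (simp add: t_def del: mult_Suc)
    have "t F mod Suc n = a F mod Suc n"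
      unfolding t_def by (rule mod_mult_self4)
    then show "cyc_arc (Suc n) (t F) (l F) = X F"
      using arc[OF that] cyc_arc_cong by metis
  qed
  have short: "t F < Suc n * (h - 1) \<longleftrightarrow> l F < h" if "F \<in> facets P" for F
  proof -
    have "t F < Suc n * (h - 1) \<longleftrightarrow> t F div Suc n < h - 1"
      by (simp add: div_less_iff_less_mult mult.commute)
    then show ?thesis
      using t(1)[OF that] by linarith
  qed
  obtain g :: "nat \<Rightarrow> int" where g: "\<And>t. t < Suc n * (h - 1) \<Longrightarrow> 0 \<le> g t \<and> g t < C"
    and g_eq: "\<And>t t'. t < t' \<Longrightarrow> t' < Suc n * (h - 1) \<Longrightarrow> g t = g t' \<Longrightarrow> t' - t \<le> t div Suc n + 1"
    using short_arc_colouring[OF h] unfolding C_def by metis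
  define c where "c F = (if l F < h then g (t F) else C + int (l F - h))" for F
  define m where "m = nat (C + (int n - int h + 1))"
  have m: "int m = C + (int n - int h + 1)"
    using \<open>C \<ge> 0\<close> h2 h(1) by (simp add: m_def)
  have c: "0 \<le> c F \<and> c F < int m" if "F \<in> facets P" for F
    using g[of "t F"] short[OF that] arc[OF that] \<open>C \<ge> 0\<close> h2 h(1) m by (auto simp: c_def)
  have short_sep: "separated P F G"
    if "F \<in> facets P" "G \<in> facets P" "l F < h" "l G < h" "g (t F) = g (t G)" "t F < t G" for F G
  proof -
    have "t G - t F \<le> t F div Suc n + 1"
      using g_eq that short by blast
    then have "crossing ?B (cyc_arc (Suc n) (t F) (l F)) (cyc_arc (Suc n) (t G) (l G))"
      using crossing_short_arcs[of "t F" "t G" n] that h2 unfolding t(1)[OF that(1)] t(1)[OF that(2)]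
      by linarith
    then show ?thesis
      using sep that t(2) by metis
  qed
  have sep_sym: "separated P F G \<longleftrightarrow> separated P G F" for F G
    by (auto simp: separated_def)
  have c_sep: "separated P F G"
    if FG: "F \<in> facets P" "G \<in> facets P" "F \<noteq> G" and eq: "c F = c G" for F G
  proof -
    have neq: "X F \<noteq> X G"
      using inj FG by (meson inj_onD)
    have same_kind: "l F < h \<longleftrightarrow> l G < h"
      using g[of "t F"] g[of "t G"] short FG eq by (auto simp: c_def split: if_splits)
    show ?thesis
    proof (cases "l F < h")
      case True
      have "t F \<noteq> t G"
        using neq t FG by metis
      then show ?thesis
        using short_sep[of F G] short_sep[of G F] sep_sym True same_kind FG eq
        by (auto simp: c_def neq_iff)
    next
      case False
      then have "l F = l G"
        using same_kind eq by (auto simp: c_def)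
      then have "crossing ?B (X F) (X G)"
        using crossing_long_arcs[of "a F" n "a G" "l F"] arc[of F] arc[of G] FG neq h2 False
        by simp
      then show ?thesis
        using sep FG by blast
    qed
  qed
  have "proper_colouring P m (\<lambda>F. nat (c F) + 1)"
    unfolding proper_colouring_def
  proof (intro conjI ballI impI)
    show "(\<lambda>F. nat (c F) + 1) ` facets P \<subseteq> {1..m}"
      using c by (fastforce simp: nat_less_iff Suc_le_eq)
    fix F G
    assume "F \<in> facets P" "G \<in> facets P" "F \<noteq> G \<and> nat (c F) + 1 = nat (c G) + 1"
    then show "separated P F G"
      using c_sep c by (metis add_right_cancel eq_nat_nat_iff)
  qed
  then have "chromatic_number P \<le> m"
    by (rule chromatic_number_le)
  then show ?thesis
    using m bound_eq[OF h] unfolding C_def h_def by linarith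
qed

end
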